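(* Let $k\geqslant 2$ be an integer and let $f$ be a primitive $k$-regular sequence, with basis $\{f=f_1,\ldots,f_d\}\subseteq\ker_k(f)$ of $\mathcal{V}_k(f)$ and associated digit matrices ${\bf B}_0,\ldots,{\bf B}_{k-1}$ as described in the context. Then, as $n\to\infty$, the vectors $\boldsymbol{\mu}_{f,n}=(\mu_{n,1},\ldots,\mu_{n,d})^T$ of pure point measures converge weakly to a vector of probability measures $\boldsymbol{\mu}_f=(\mu_f,\ldots,\mu_f)^T$ on $\mathbb{T}$; that is, for every $i\in\{1,\ldots,d\}$ the measures $\mu_{n,i}$ converge weakly to one and the same probability measure $\mu_f$ on $\mathbb{T}$.
   Context: Let $k\geqslant 2$ be an integer. For an integer sequence $f=(f(m))_{m\geqslant 0}$ its $k$-kernel is $\ker_k(f)=\{(f(k^\ell n+r))_{n\geqslant 0}:\ell\geqslant 0,\ 0\leqslant r<k^\ell\}$; $f$ is $k$-regular if the $\mathbb{Q}$-vector space $\mathcal{V}_k(f)$ spanned by $\ker_k(f)$ is finite-dimensional. Fix a basis $\{f=f_1,f_2,\ldots,f_d\}\subseteq\ker_k(f)$ of $\mathcal{V}_k(f)$ consisting of integer sequences, put ${\bf f}(m)=(f_1(m),\ldots,f_d(m))^T$, and for each $a\in\{0,\ldots,k-1\}$ let ${\bf B}_a$ be the $d\times d$ integer matrix with ${\bf f}(km+a)={\bf B}_a{\bf f}(m)$ for all $m\geqslant 0$. Set ${\bf B}=\sum_{a=0}^{k-1}{\bf B}_a$. The sequence $f$ is called primitive if $f$ takes non-negative integer values,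 is not eventually zero, each ${\bf B}_a$ has non-negative entries and ${\bf B}$ has all entries strictly positive. Let $\mathbb{T}=[0,1)$ with addition modulo $1$. For $i\in\{1,\ldots,d\}$ and $n\geqslant 0$ put $\varSigma_i(n)=\sum_{m=k^n}^{k^{n+1}-1}f_i(m)$ and $\mu_{n,i}=\frac{1}{\varSigma_i(n)}\sum_{m=0}^{k^{n+1}-k^n-1}f_i(k^n+m)\,\delta_{m/(k^n(k-1))}$, a pure point probability measure on $\mathbb{T}$, where $\delta_x$ is the unit Dirac measure at $x$; set $\boldsymbol{\mu}_{f,n}=(\mu_{n,1},\ldots,\mu_{n,d})^T$. *)

theory Defs
  imports "HOL-Probability.Probability" "HOL-Library.Function_Algebras"
begin

section \<open>Regular sequences\<close>

definition kernel :: "nat \<Rightarrow> (nat \<Rightarrow> int) \<Rightarrow> (nat \<Rightarrow> int) set" where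
  "kernel k f = {(\<lambda>n. f (k ^ l * n + r)) | l r. r < k ^ l}"

text \<open>The rational vector space of all sequences \<open>nat \<Rightarrow> rat\<close>, with pointwise operations
  (addition comes from \<^theory>\<open>HOL-Library.Function_Algebras\<close>).\<close>

definition seq_scale :: "rat \<Rightarrow> (nat \<Rightarrow> rat) \<Rightarrow> (nat \<Rightarrow> rat)" where
  "seq_scale c u = (\<lambda>n. c * u n)"

interpretation rat_seq: vector_space seq_scale
  by unfold_locales (auto simp: seq_scale_def algebra_simps)

definition seq_of_int :: "(nat \<Rightarrow> int) \<Rightarrow> (nat \<Rightarrow> rat)" where
  "seq_of_int u = (\<lambda>n. of_int (u n))"

definition kernel_space :: "nat \<Rightarrow> (nat \<Rightarrow> int) \<Rightarrow> (nat \<Rightarrow> rat) set" where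
  "kernel_space k f = rat_seq.span (seq_of_int ` kernel k f)"

definition regular_seq :: "nat \<Rightarrow> (nat \<Rightarrow> int) \<Rightarrow> bool" where
  "regular_seq k f \<longleftrightarrow> (\<exists>S. finite S \<and> rat_seq.span S = kernel_space k f)"

text \<open>The basis is a family indexed by a finite type \<open>'d\<close> (so \<open>d = CARD('d)\<close>), and \<open>i1\<close> plays the
  role of the index \<open>1\<close>. Injectivity has to be required separately, because independence only
  concerns the range of the family.\<close>

definition kernel_basis :: "nat \<Rightarrow> (nat \<Rightarrow> int) \<Rightarrow> 'd::finite \<Rightarrow> ('d \<Rightarrow> nat \<Rightarrow> int) \<Rightarrow> bool" where
  "kernel_basis k f i1 fs \<longleftrightarrow>
     fs i1 = f \<and> inj fs \<and> range fs \<subseteq> kernel k f \<and>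
     \<not> rat_seq.dependent (seq_of_int ` range fs) \<and>
     rat_seq.span (seq_of_int ` range fs) = kernel_space k f"

definition seq_vec :: "('d::finite \<Rightarrow> nat \<Rightarrow> int) \<Rightarrow> nat \<Rightarrow> int ^ 'd" where
  "seq_vec fs m = (\<chi> i. fs i m)"

definition digit_matrices ::
  "nat \<Rightarrow> ('d::finite \<Rightarrow> nat \<Rightarrow> int) \<Rightarrow> (nat \<Rightarrow> int ^ 'd ^ 'd) \<Rightarrow> bool" where
  "digit_matrices k fs B \<longleftrightarrow> (\<forall>a<k. \<forall>m. seq_vec fs (k * m + a) = B a *v seq_vec fs m)"

text \<open>Primitivity refers to the chosen basis through its digit matrices.\<close>

definition primitive_seq :: "nat \<Rightarrow> (nat \<Rightarrow> int) \<Rightarrow> (nat \<Rightarrow> int ^ 'd ^ 'd::finite) \<Rightarrow> bool" where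
  "primitive_seq k f B \<longleftrightarrow>
     (\<forall>m. 0 \<le> f m) \<and> \<not> (\<forall>\<^sub>F m in sequentially. f m = 0) \<and>
     (\<forall>a<k. \<forall>i j. 0 \<le> B a $ i $ j) \<and>
     (\<forall>i j. 0 < (\<Sum>a<k. B a) $ i $ j)"


section \<open>The circle\<close>

text \<open>The circle is the set \<open>{0..<1}\<close> with the topology of the reals modulo 1, i.e. the quotient
  topology along \<^const>\<open>frac\<close>; it differs from the subspace topology at \<open>0\<close>.\<close>

definition circle :: "real topology" where
  "circle = topology (\<lambda>U. U \<subseteq> {0..<1} \<and> open (frac -` U))"

lemma openin_circle: "openin circle U \<longleftrightarrow> U \<subseteq> {0..<1} \<and> open (frac -` U)"
proof -
  have "istopology (\<lambda>U. U \<subseteq> {0..<1::real} \<and> open (frac -` U :: real set))"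
    unfolding istopology_def by (auto simp: vimage_Int vimage_Union)
  then show ?thesis
    unfolding circle_def by (simp add: topology_inverse')
qed

lemma topspace_circle: "topspace circle = {0..<1}"
proof -
  have "frac -` {0..<1::real} = (UNIV :: real set)"
    by (auto simp: frac_lt_1)
  then have "openin circle {0..<1}"
    by (simp add: openin_circle)
  then show ?thesis
    using openin_subset openin_circle openin_topspace by blast
qed

lemma quotient_map_circle: "quotient_map euclidean circle (frac :: real \<Rightarrow> real)"
proof -
  have "range (frac :: real \<Rightarrow> real) = {0..<1}"
  proof
    show "{0..<1} \<subseteq> range (frac :: real \<Rightarrow> real)"
    proof
      fix x :: real assume "x \<in> {0..<1}"
      then have "x = frac x" by (simp add: frac_eq)
      then show "x \<in> range frac" by blast
    qed
  qed (auto simp: frac_lt_1)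
  then show ?thesis
    unfolding quotient_map_def by (auto simp: topspace_circle openin_circle vimage_def)
qed

definition circle_borel :: "real measure" where
  "circle_borel = sigma (topspace circle) {U. openin circle U}"

text \<open>Since the circle is compact, all continuous test functions are bounded.\<close>

definition weak_conv_circle :: "(nat \<Rightarrow> real measure) \<Rightarrow> real measure \<Rightarrow> bool" where
  "weak_conv_circle M N \<longleftrightarrow>
     (\<forall>g. continuous_map circle euclideanreal g \<longrightarrow>
        (\<lambda>n. \<integral>x. g x \<partial>M n) \<longlonglongrightarrow> (\<integral>x. g x \<partial>N))"


section \<open>The approximating pure point measures\<close>

definition Sig :: "nat \<Rightarrow> (nat \<Rightarrow> int) \<Rightarrow> nat \<Rightarrow> int" where
  "Sig k u n = (\<Sum>m = k ^ n..k ^ (n + 1) - 1. u m)"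

text \<open>If \<open>Sig k u n = 0\<close> then \<open>mu k u n\<close> is the zero measure, as division by zero yields zero. For
  the basis sequences of a primitive sequence this can occur only at \<open>n = 0\<close>.\<close>

definition mu :: "nat \<Rightarrow> (nat \<Rightarrow> int) \<Rightarrow> nat \<Rightarrow> real measure" where
  "mu k u n = measure_of (space circle_borel) (sets circle_borel)
     (\<lambda>A. \<Sum>m = 0..k ^ (n + 1) - k ^ n - 1.
        ennreal (of_int (u (k ^ n + m)) / of_int (Sig k u n)) *
        emeasure (return circle_borel (real m / (real (k ^ n) * (real k - 1)))) A)"

lemma space_mu: "space (mu k u n) = {0..<1}"
  by (simp add: mu_def circle_borel_def space_measure_of_conv topspace_circle)

lemma sets_mu: "sets (mu k u n) = sets circle_borel"
  unfolding mu_def by (simp add: sets.space_closed sets.sigma_sets_eq)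

lemma emeasure_mu:
  assumes "A \<in> sets circle_borel"
  shows "emeasure (mu k u n) A =
    (\<Sum>m = 0..k ^ (n + 1) - k ^ n - 1.
        ennreal (of_int (u (k ^ n + m)) / of_int (Sig k u n)) *
        emeasure (return circle_borel (real m / (real (k ^ n) * (real k - 1)))) A)"
proof (rule emeasure_measure_of[OF mu_def])
  let ?F = "\<lambda>A. \<Sum>m = 0..k ^ (n + 1) - k ^ n - 1.
        ennreal (of_int (u (k ^ n + m)) / of_int (Sig k u n)) *
        emeasure (return circle_borel (real m / (real (k ^ n) * (real k - 1)))) A"
  show "sets circle_borel \<subseteq> Pow (space circle_borel)"
    by (rule sets.space_closed)
  show "A \<in> sets (mu k u n)"
    using assms by (simp add: sets_mu)
  show "positive (sets (mu k u n)) ?F"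
    by (simp add: positive_def)
  show "countably_additive (sets (mu k u n)) ?F"
  proof (rule countably_additiveI)
    fix A :: "nat \<Rightarrow> real set"
    assume A: "range A \<subseteq> sets (mu k u n)" "disjoint_family A"
    have suma: "(\<Sum>i. emeasure (return circle_borel x) (A i)) =
        emeasure (return circle_borel x) (\<Union>i. A i)" for x
      using A by (intro suminf_emeasure) (auto simp: sets_mu)
    show "(\<Sum>i. ?F (A i)) = ?F (\<Union>i. A i)"
      by (subst suminf_sum) (auto simp: suma)
  qed
qed

end

theory Submission
  imports Defs
begin

text \<open>For fixed \<open>p\<close>, let \<open>X t\<close> be the vector of the sums of \<open>fs i m\<close> over all \<open>m\<close> whose base-\<open>k\<close>
  expansion is that of \<open>p\<close> followed by \<open>t\<close> further digits. It satisfies the same recursion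
  \<open>X (t + 1) = B X t\<close> as the total mass. As \<open>B\<close> is positive, the componentwise quotients of two such sequences are repeatedly averaged with weights
  bounded below, so that they converge to a limit independent of the component. Hence the masses
  of all \<open>k\<close>-adic arcs converge, and by uniform continuity, if the integrals of a continuous
  function against \<open>mu k (fs i) n\<close> converge along some subsequence for one \<open>i\<close>, then they converge to
  the same value along the full sequence for every \<open>i\<close>. Helly's selection theorem, applied on the real
  line, provides the subsequence; its limit may charge the point 1, so it is pushed to the circle
  by \<^const>\<open>frac\<close>.\<close>

section \<open>Ratios of solutions of a positive linear recursion\<close>

text \<open>Every new value puts weight at least \<delta> on the old minimum, so the maximum drops
  by at least \<delta> times the oscillation while the minimum does not decrease. The oscillation
  thus shrinks by the factor \<open>1 - \<delta>\<close> at each step.\<close>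

lemma averaging_common_limit:
  fixes q :: "nat \<Rightarrow> 'd::finite \<Rightarrow> real" and w :: "nat \<Rightarrow> 'd \<Rightarrow> 'd \<Rightarrow> real"
  assumes \<delta>: "0 < \<delta>" "\<And>n i j. \<delta> \<le> w n i j"
    and w1: "\<And>n i. (\<Sum>j\<in>UNIV. w n i j) = 1"
    and q: "\<And>n i. q (Suc n) i = (\<Sum>j\<in>UNIV. w n i j * q n j)"
  shows "\<exists>L. \<forall>i. (\<lambda>n. q n i) \<longlonglongrightarrow> L"
proof -
  define hi where "hi n = Max (range (q n))" for n
  define lo where "lo n = Min (range (q n))" for n
  have hi: "q n i \<le> hi n" and lo: "lo n \<le> q n i" for n i
    by (auto simp: hi_def lo_def)
  have w0: "0 \<le> w n i j" for n i j
    using \<delta> less_eq_real_def order_trans by blast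
  have "w n i j \<le> 1" for n i j
    using member_le_sum[of j UNIV "w n i"] w0 w1 by simp
  then have \<delta>1: "\<delta> \<le> 1"
    using \<delta> order_trans by blast
  have ge: "lo n \<le> q (Suc n) i" for n i
  proof -
    have "lo n = (\<Sum>j\<in>UNIV. w n i j * lo n)"
      by (simp add: w1 flip: sum_distrib_right)
    also have "\<dots> \<le> q (Suc n) i"
      unfolding q by (intro sum_mono mult_left_mono lo w0)
    finally show ?thesis .
  qed
  have le: "q (Suc n) i \<le> hi n - \<delta> * (hi n - lo n)" for n i
  proof -
    have "lo n \<in> range (q n)"
      unfolding lo_def by (intro Min_in) auto
    then obtain j0 where j0: "q n j0 = lo n"
      by force
    have "\<delta> * (hi n - lo n) \<le> w n i j0 * (hi n - q n j0)"
      unfolding j0 by (intro mult_right_mono \<delta>) (meson hi lo order_trans diff_ge_0_iff_ge)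
    also have "\<dots> \<le> (\<Sum>j\<in>UNIV. w n i j * (hi n - q n j))"
      by (intro member_le_sum) (auto simp: w0 hi)
    also have "\<dots> = hi n - q (Suc n) i"
      by (simp add: q w1 right_diff_distrib sum_subtractf flip: sum_distrib_right)
    finally show ?thesis by simp
  qed
  have lo_le_hi: "lo n \<le> hi n" for n
    using hi lo order_trans by blast
  have hi_Suc: "hi (Suc n) \<le> hi n - \<delta> * (hi n - lo n)" for n
    unfolding hi_def[of "Suc n"] using le by auto
  have lo_Suc: "lo n \<le> lo (Suc n)" for n
    unfolding lo_def[of "Suc n"] using ge by auto
  have "hi n - lo n \<le> (1 - \<delta>) ^ n * (hi 0 - lo 0)" for n
  proof (induction n)
    case (Suc n)
    have "hi (Suc n) - lo (Suc n) \<le> (1 - \<delta>) * (hi n - lo n)"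
      using hi_Suc[of n] lo_Suc[of n] by (simp add: algebra_simps)
    also have "\<dots> \<le> (1 - \<delta>) * ((1 - \<delta>) ^ n * (hi 0 - lo 0))"
      using Suc \<delta>1 by (intro mult_left_mono) auto
    finally show ?case by (simp add: mult.assoc)
  qed simp
  moreover have "(\<lambda>n. (1 - \<delta>) ^ n * (hi 0 - lo 0)) \<longlonglongrightarrow> 0"
    using \<delta> \<delta>1 by (intro tendsto_mult_left_zero LIMSEQ_power_zero) auto
  ultimately have osc: "(\<lambda>n. hi n - lo n) \<longlonglongrightarrow> 0"
    using lo_le_hi by (intro tendsto_sandwich[of "\<lambda>_. 0" "\<lambda>n. hi n - lo n"]) auto
  have "decseq hi"
    using hi_Suc \<delta> lo_le_hi
    by (intro decseq_SucI) (smt (verit) mult_nonneg_nonneg)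
  moreover have "lo 0 \<le> hi n" for n
    using lift_Suc_mono_le[of lo 0 n] lo_Suc lo_le_hi order_trans by blast
  ultimately obtain L where L: "hi \<longlonglongrightarrow> L"
    using decseq_convergent by blast
  have "lo \<longlonglongrightarrow> L"
    using tendsto_diff[OF L osc] by simp
  then have "(\<lambda>n. q n i) \<longlonglongrightarrow> L" for i
    using L hi lo by (intro tendsto_sandwich[of lo "\<lambda>n. q n i" _ hi]) auto
  then show ?thesis by blast
qed

text \<open>Dividing by \<open>S\<close> turns the recursion of \<open>X\<close> into an averaging
  of the quotients with weights \<open>A i j * S n j / S (Suc n) i\<close>, which sum to 1 by the
  recursion of \<open>S\<close>.\<close>

lemma positive_matrix_ratio_limit:
  fixes A :: "'d::finite \<Rightarrow> 'd \<Rightarrow> real" and X S :: "nat \<Rightarrow> 'd \<Rightarrow> real"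
  assumes A: "\<And>i j. 0 < A i j"
    and X: "\<And>n i. X (Suc n) i = (\<Sum>j\<in>UNIV. A i j * X n j)"
    and S: "\<And>n i. S (Suc n) i = (\<Sum>j\<in>UNIV. A i j * S n j)"
    and S0: "\<And>n i. 0 < S n i"
  shows "\<exists>L. \<forall>i. (\<lambda>n. X n i / S n i) \<longlonglongrightarrow> L"
proof -
  \<comment> \<open>A bound for the quotient of any two entries of \<open>A\<close>.\<close>
  define K where "K = Max (range (\<lambda>((i, j), (i', j')). A i j / A i' j'))"
  have "A i j / A i' j' \<le> K" for i j i' j'
    unfolding K_def by (rule Max_ge) (auto intro: image_eqI[of _ _ "((i, j), (i', j'))"])
  then have K: "A i j \<le> K * A i' j'" for i j i' j'
    using A by (simp add: pos_divide_le_eq)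
  have K0: "0 < K"
    using K A by (metis less_le_trans zero_less_mult_pos2)
  \<comment> \<open>After one step the components of \<open>S\<close> are comparable, which bounds the weights below.\<close>
  have SK: "S (Suc n) i \<le> K * S (Suc n) j" for n i j
  proof -
    have "S (Suc n) i \<le> (\<Sum>l\<in>UNIV. K * A j l * S n l)"
      unfolding S using K S0 by (intro sum_mono mult_right_mono) (auto intro: less_imp_le)
    also have "\<dots> = K * S (Suc n) j"
      by (simp add: S sum_distrib_left mult.assoc)
    finally show ?thesis .
  qed
  define w where "w n i j = A i j * S (Suc n) j / S (Suc (Suc n)) i" for n i j
  have low: "1 / (real CARD('d) * (K * K)) \<le> w n i j" for n i j
  proof -
    \<comment> \<open>Replacing each of the \<open>CARD('d)\<close> summands by the one at
      \<open>j\<close> costs a factor \<open>K\<close> for the entry of \<open>A\<close> and another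
      for the component of \<open>S\<close>.\<close>
    have "S (Suc (Suc n)) i \<le> (\<Sum>l\<in>(UNIV::'d set). (K * A i j) * (K * S (Suc n) j))"
      unfolding S[of "Suc n"]
      using K SK S0 A K0 by (intro sum_mono mult_mono) (auto intro: less_imp_le)
    also have "\<dots> = real CARD('d) * (K * K) * (A i j * S (Suc n) j)"
      by simp
    finally show ?thesis
      unfolding w_def using S0[of "Suc (Suc n)" i] K0
      by (simp add: divide_simps mult_ac)
  qed
  have "\<exists>L. \<forall>i. (\<lambda>n. X (Suc n) i / S (Suc n) i) \<longlonglongrightarrow> L"
  proof (rule averaging_common_limit[of "1 / (real CARD('d) * (K * K))" w])
    show "0 < 1 / (real CARD('d) * (K * K))"
      using K0 by simp
    show "(\<Sum>j\<in>UNIV. w n i j) = 1" for n i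
      using S0[of "Suc (Suc n)" i] S[of "Suc n" i] by (simp add: w_def flip: sum_divide_distrib)
    show "X (Suc (Suc n)) i / S (Suc (Suc n)) i = (\<Sum>j\<in>UNIV. w n i j * (X (Suc n) j / S (Suc n) j))" for n i
    proof -
      have "w n i j * (X (Suc n) j / S (Suc n) j) = A i j * X (Suc n) j / S (Suc (Suc n)) i" for j
        using S0[of "Suc n" j] by (simp add: w_def)
      then show ?thesis
        by (simp add: X[of "Suc n"] sum_divide_distrib)
    qed
  qed (rule low)
  then show ?thesis
    by (subst (asm) filterlim_sequentially_Suc)
qed

section \<open>Test functions and measurability on the circle\<close>

text \<open>Lifts a test function to a 1-periodic one on the real line, where the selection theorem
  is applied.\<close>

lemma continuous_map_circle_compose_frac:
  assumes "continuous_map circle euclideanreal g"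
  shows "continuous_on UNIV (\<lambda>x. g (frac x))"
  using continuous_map_compose[OF quotient_imp_continuous_map[OF quotient_map_circle] assms]
  by (simp add: o_def)

lemma space_circle_borel: "space circle_borel = {0..<1}"
  by (simp add: circle_borel_def space_measure_of_conv topspace_circle)

lemma borel_measurable_circle:
  assumes "continuous_map circle euclideanreal g"
  shows "g \<in> borel_measurable circle_borel"
proof (rule borel_measurableI)
  fix S :: "real set" assume "open S"
  then have "openin circle {x \<in> topspace circle. g x \<in> S}"
    using assms by (auto intro: openin_continuous_map_preimage)
  moreover have "{U. openin circle U} \<subseteq> Pow (topspace circle)"
    using openin_subset by blast
  moreover have "g -` S \<inter> space circle_borel = {x \<in> topspace circle. g x \<in> S}"
    by (auto simp: space_circle_borel topspace_circle)
  ultimately show "g -` S \<inter> space circle_borel \<in> sets circle_borel"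
    unfolding circle_borel_def by auto
qed

lemma frac_measurable_circle: "frac \<in> measurable borel circle_borel"
  unfolding circle_borel_def
proof (rule measurable_measure_of)
  show "{U. openin circle U} \<subseteq> Pow (topspace circle)"
    using openin_subset by blast
qed (auto simp: topspace_circle frac_lt_1 openin_circle)

section \<open>The approximating measures as images of weighted index sets\<close>

text \<open>Atoms are indexed by the argument of the sequence, i.e. by \<open>k ^ n + m\<close> instead of \<open>m\<close>.\<close>

definition atom_pos :: "nat \<Rightarrow> nat \<Rightarrow> nat \<Rightarrow> real" where
  "atom_pos k n m = real (m - k ^ n) / (real (k ^ n) * (real k - 1))"

text \<open>A measure on indices rather than positions, so that it can be pushed forward both to the
  circle and to the real line.\<close>

definition atoms :: "nat \<Rightarrow> (nat \<Rightarrow> int) \<Rightarrow> nat \<Rightarrow> nat measure" where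
  "atoms k u n = point_measure {k ^ n..<k ^ Suc n} (\<lambda>m. ennreal (of_int (u m) / of_int (Sig k u n)))"

lemma atom_pos_bounds:
  assumes "k \<ge> 2" "m \<in> {k ^ n..<k ^ Suc n}"
  shows "0 \<le> atom_pos k n m" "atom_pos k n m < 1"
proof -
  show "0 \<le> atom_pos k n m"
    using assms(1) by (simp add: atom_pos_def)
  have "real (m - k ^ n) < real (k ^ n) * (real k - 1)"
    using assms by (simp add: of_nat_diff algebra_simps flip: of_nat_mult of_nat_power)
  then show "atom_pos k n m < 1"
    using assms(1) by (simp add: atom_pos_def divide_less_eq)
qed

lemma atom_pos_measurable_circle:
  assumes "k \<ge> 2"
  shows "atom_pos k n \<in> measurable (atoms k u n) circle_borel"
  using atom_pos_bounds[OF assms]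
  by (auto simp: atoms_def measurable_def space_point_measure sets_point_measure space_circle_borel)

lemma Sig_eq:
  assumes "k \<ge> 2"
  shows "Sig k u n = (\<Sum>m\<in>{k ^ n..<k ^ Suc n}. u m)"
proof -
  have "k ^ n < k ^ Suc n"
    using assms by simp
  then have "{k ^ n..k ^ (n + 1) - 1} = {k ^ n..<k ^ Suc n}"
    by (auto simp del: power_Suc)
  then show ?thesis
    by (simp add: Sig_def)
qed

text \<open>Through this and \<open>integral_atoms\<close>, integrals against \<open>mu\<close>
  become finite sums.\<close>

lemma mu_eq_distr:
  assumes k: "k \<ge> 2"
  shows "mu k u n = distr (atoms k u n) circle_borel (atom_pos k n)"
proof (rule measure_eqI)
  show "sets (mu k u n) = sets (distr (atoms k u n) circle_borel (atom_pos k n))"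
    by (simp add: sets_mu)
  fix A assume "A \<in> sets (mu k u n)"
  then have A: "A \<in> sets circle_borel"
    by (simp add: sets_mu)
  let ?c = "\<lambda>m. ennreal (of_int (u m) / of_int (Sig k u n))"
  note meas = atom_pos_measurable_circle[OF k]
  have lt: "k ^ n < k ^ Suc n"
    using k by simp
  then have set_eq: "{k ^ n..<k ^ Suc n} = (\<lambda>m. k ^ n + m) ` {0..k ^ (n + 1) - k ^ n - 1}"
  proof -
    have "{0..k ^ (n + 1) - k ^ n - 1} = {0..<k ^ Suc n - k ^ n}"
      using lt by (auto simp del: power_Suc)
    then show ?thesis
      using lt by (simp add: image_add_atLeastLessThan)
  qed
  have "emeasure (distr (atoms k u n) circle_borel (atom_pos k n)) A
      = (\<Sum>m | m \<in> {k ^ n..<k ^ Suc n} \<and> atom_pos k n m \<in> A. ?c m)"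
    unfolding emeasure_distr[OF meas A] unfolding atoms_def
    by (subst emeasure_point_measure_finite)
      (auto simp: space_point_measure intro!: sum.cong)
  also have "\<dots> = (\<Sum>m\<in>{k ^ n..<k ^ Suc n}. ?c m * indicator A (atom_pos k n m))"
    by (intro sum.mono_neutral_cong_left) (auto simp: indicator_def)
  also have "\<dots> = emeasure (mu k u n) A"
    unfolding emeasure_mu[OF A] set_eq
    by (subst sum.reindex) (auto simp: atom_pos_def A intro!: sum.cong)
  finally show "emeasure (mu k u n) A = emeasure (distr (atoms k u n) circle_borel (atom_pos k n)) A" ..
qed

lemma prob_space_atoms:
  assumes pos: "\<And>m. 0 \<le> u m" and S: "0 < Sig k u n" and k: "k \<ge> 2"
  shows "prob_space (atoms k u n)"
proof
  note Sig = Sig_eq[OF k]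
  have "(\<Sum>m\<in>{k ^ n..<k ^ Suc n}. ennreal (of_int (u m) / of_int (Sig k u n)))
      = ennreal (\<Sum>m\<in>{k ^ n..<k ^ Suc n}. of_int (u m) / of_int (Sig k u n))"
    using pos S by (intro sum_ennreal) auto
  also have "(\<Sum>m\<in>{k ^ n..<k ^ Suc n}. real_of_int (u m) / of_int (Sig k u n)) = 1"
    using S by (simp add: Sig del: power_Suc flip: sum_divide_distrib of_int_sum)
  finally show "emeasure (atoms k u n) (space (atoms k u n)) = 1"
    unfolding atoms_def by (simp add: space_point_measure emeasure_point_measure_finite del: power_Suc)
qed

lemma integral_atoms:
  fixes h :: "nat \<Rightarrow> real"
  assumes "\<And>m. 0 \<le> u m"
  shows "(\<integral>m. h m \<partial>atoms k u n) =
    (\<Sum>m\<in>{k ^ n..<k ^ Suc n}. of_int (u m) * h m) / of_int (Sig k u n)"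
proof -
  \<comment> \<open>The case \<open>Sig k u n = 0\<close> is covered: division by zero makes both
    sides 0.\<close>
  have "0 \<le> Sig k u n"
    unfolding Sig_def using assms by (intro sum_nonneg) auto
  then show ?thesis
    unfolding atoms_def using assms
    by (subst lebesgue_integral_point_measure_finite)
      (auto simp: sum_divide_distrib simp del: power_Suc intro!: sum.cong)
qed

section \<open>Digit recursion and masses of arcs\<close>

text \<open>Used with \<open>K = k\<close> to split off the last digit and with
  \<open>K = k ^ t\<close> to split off the last \<open>t\<close> digits.\<close>

lemma sum_blocks:
  fixes g :: "nat \<Rightarrow> 'b::comm_monoid_add"
  shows "(\<Sum>m\<in>{a * K..<b * K}. g m) = (\<Sum>p\<in>{a..<b}. \<Sum>m\<in>{p * K..<Suc p * K}. g m)"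
proof (induction b)
  case (Suc b)
  show ?case
  proof (cases "a \<le> b")
    case True
    then have "(\<Sum>m\<in>{a * K..<Suc b * K}. g m) = (\<Sum>m\<in>{a * K..<b * K}. g m) + (\<Sum>m\<in>{b * K..<Suc b * K}. g m)"
      by (intro sum.atLeastLessThan_concat[symmetric]) auto
    then show ?thesis
      using Suc True by simp
  next
    case False
    then have "Suc b * K \<le> a * K"
      by (intro mult_le_mono1) simp
    with False show ?thesis
      by (simp del: mult_Suc)
  qed
qed simp

text \<open>The real-valued data behind the convergence argument. \<open>F_nonzero\<close> asks for
  \<open>1 \<le> m\<close> because 0 lies in none of the intervals
  \<open>{k ^ n..<k ^ Suc n}\<close>.\<close>

locale primitive_digit_system =
  fixes k :: nat and F :: "'d::finite \<Rightarrow> nat \<Rightarrow> real" and b :: "nat \<Rightarrow> 'd \<Rightarrow> 'd \<Rightarrow> real"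
  assumes k: "k \<ge> 2"
    and F_nonneg: "\<And>i m. 0 \<le> F i m"
    and F_digit: "\<And>i m a. a < k \<Longrightarrow> F i (k * m + a) = (\<Sum>j\<in>UNIV. b a i j * F j m)"
    and b_pos: "\<And>i j. 0 < (\<Sum>a<k. b a i j)"
    and F_nonzero: "\<exists>i m. 1 \<le> m \<and> F i m \<noteq> 0"
begin

definition S :: "nat \<Rightarrow> 'd \<Rightarrow> real" where
  "S n i = (\<Sum>m\<in>{k ^ n..<k ^ Suc n}. F i m)"

text \<open>The scaled interval consists of the one-digit extensions of the original one; summing
  over the new digit adds up the digit matrices. Hence total masses and block masses obey the same
  recursion.\<close>

lemma interval_sum_digits:
  "(\<Sum>m\<in>{x * k..<y * k}. F i m) = (\<Sum>j\<in>UNIV. (\<Sum>a<k. b a i j) * (\<Sum>m\<in>{x..<y}. F j m))"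
proof -
  have "(\<Sum>m\<in>{q * k..<Suc q * k}. F i m) = (\<Sum>a<k. F i (k * q + a))" for q
  proof -
    have "{q * k..<Suc q * k} = (\<lambda>a. k * q + a) ` {..<k}"
      using image_add_atLeastLessThan[of "k * q" 0 k] by (simp add: mult.commute atLeast0LessThan add.commute)
    then show ?thesis
      by (simp add: sum.reindex)
  qed
  moreover have "(\<Sum>a<k. F i (k * q + a)) = (\<Sum>a<k. \<Sum>j\<in>UNIV. b a i j * F j q)" for q
    by (intro sum.cong refl F_digit) simp
  ultimately have "(\<Sum>m\<in>{x * k..<y * k}. F i m) = (\<Sum>q\<in>{x..<y}. \<Sum>a<k. \<Sum>j\<in>UNIV. b a i j * F j q)"
    by (subst sum_blocks) (simp only:)
  also have "\<dots> = (\<Sum>q\<in>{x..<y}. \<Sum>j\<in>UNIV. (\<Sum>a<k. b a i j) * F j q)"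
    by (intro sum.cong refl, subst sum.swap) (simp add: sum_distrib_right)
  also have "\<dots> = (\<Sum>j\<in>UNIV. (\<Sum>a<k. b a i j) * (\<Sum>m\<in>{x..<y}. F j m))"
    by (subst sum.swap) (simp add: sum_distrib_left)
  finally show ?thesis .
qed

lemma S_Suc: "S (Suc n) i = (\<Sum>j\<in>UNIV. (\<Sum>a<k. b a i j) * S n j)"
  unfolding S_def using interval_sum_digits[where x = "k ^ n" and y = "k ^ Suc n" and i = i] by (simp add: mult.commute)

lemma S_nonneg: "0 \<le> S n i"
  unfolding S_def by (intro sum_nonneg F_nonneg)

text \<open>One positive component makes all components positive a step later. Some component of
  \<open>S 0\<close> is positive, since otherwise the recursion would make every \<open>S n\<close>
  vanish, against \<open>F_nonzero\<close>. Other components of \<open>S 0\<close> may be 0, hence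
  the \<open>Suc\<close>.\<close>

lemma S_pos: "0 < S (Suc n) i"
proof -
  have step: "0 < S (Suc n) i" if "0 < S n j" for n i j
  proof -
    have "0 \<le> (\<Sum>a<k. b a i j') * S n j'" for j'
      using b_pos[of i j'] S_nonneg[of n j'] by simp
    then show ?thesis
      unfolding S_Suc using that b_pos by (intro sum_pos2[of _ j]) auto
  qed
  have "\<exists>j. 0 < S 0 j"
  proof (rule ccontr)
    assume "\<not> ?thesis"
    then have S0: "S 0 j = 0" for j
      using S_nonneg by (metis less_eq_real_def)
    have S_zero: "S n j = 0" for n j
      by (induction n arbitrary: j) (simp_all add: S0 S_Suc)
    obtain i m where im: "1 \<le> m" "F i m \<noteq> 0"
      using F_nonzero by blast
    obtain n where "k ^ n \<le> m" "m < k ^ (n + 1)"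
      using ex_power_ivl1[OF k im(1)] by blast
    then have "F i m \<le> S n i"
      unfolding S_def by (intro member_le_sum F_nonneg) auto
    then show False
      using S_zero[of n i] F_nonneg[of i m] im(2) by linarith
  qed
  then obtain j where "0 < S 0 j"
    by blast
  then have "0 < S (Suc n) i" for i
    by (induction n arbitrary: i) (use step in blast)+
  then show ?thesis .
qed

text \<open>The block holds the extensions of \<open>p\<close> by \<open>t\<close> digits, so
  numerator and denominator solve the same recursion in \<open>t\<close>. The limit may depend on
  \<open>p\<close>, but not on \<open>i\<close>.\<close>

lemma block_mass_limit:
  "\<exists>L. \<forall>i. (\<lambda>t. (\<Sum>m\<in>{p * k ^ t..<Suc p * k ^ t}. F i m) / S (l + t) i) \<longlonglongrightarrow> L"
proof -
  define X where "X t i = (\<Sum>m\<in>{p * k ^ t..<Suc p * k ^ t}. F i m)" for t i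
  have X_Suc: "X (Suc t) i = (\<Sum>j\<in>UNIV. (\<Sum>a<k. b a i j) * X t j)" for t i
    unfolding X_def using interval_sum_digits[where x = "p * k ^ t" and y = "Suc p * k ^ t" and i = i]
    by (simp add: mult_ac del: mult_Suc)
  \<comment> \<open>Shifted by one, so that the denominator is positive even for
    \<open>l = 0\<close>.\<close>
  have "\<exists>L. \<forall>i. (\<lambda>t. X (Suc t) i / S (l + Suc t) i) \<longlonglongrightarrow> L"
    by (rule positive_matrix_ratio_limit[OF b_pos])
      (use X_Suc S_Suc S_pos in simp_all)
  then show ?thesis
    unfolding X_def[symmetric] filterlim_sequentially_Suc[of "\<lambda>t. X t _ / S (l + t) _"] .
qed

section \<open>Convergence of integrals of continuous functions\<close>

text \<open>For the basis sequences this is the integral of \<open>h\<close> over the atom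
  positions, see \<open>atoms_mean\<close> below.\<close>

definition mean :: "(real \<Rightarrow> real) \<Rightarrow> nat \<Rightarrow> 'd \<Rightarrow> real" where
  "mean h n i = (\<Sum>m\<in>{k ^ n..<k ^ Suc n}. F i m * h (atom_pos k n m)) / S n i"

text \<open>Appending \<open>t\<close> digits moves an atom to the right by at most
  \<open>k ^ t / (k ^ (l + t) * (k - 1))\<close>.\<close>

lemma atom_pos_block:
  assumes p: "p \<in> {k ^ l..<k ^ Suc l}" and m: "m \<in> {p * k ^ t..<Suc p * k ^ t}"
  shows "\<bar>atom_pos k (l + t) m - atom_pos k l p\<bar> \<le> 1 / real (k ^ l)"
proof -
  have kt: "k ^ (l + t) \<le> p * k ^ t"
    using p by (simp add: power_add)
  \<comment> \<open>Appending zeros to \<open>p\<close> does not change its position.\<close>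
  have "atom_pos k l p = real (p * k ^ t - k ^ (l + t)) / (real (k ^ (l + t)) * (real k - 1))"
    using p k kt by (simp add: atom_pos_def power_add of_nat_diff field_simps)
  moreover have "real (m - k ^ (l + t)) - real (p * k ^ t - k ^ (l + t)) = real (m - p * k ^ t)"
    using kt m by (simp add: of_nat_diff)
  ultimately have "atom_pos k (l + t) m - atom_pos k l p = real (m - p * k ^ t) / (real (k ^ (l + t)) * (real k - 1))"
    by (simp add: atom_pos_def flip: diff_divide_distrib)
  moreover have "0 \<le> \<dots>"
    using k by simp
  moreover have "\<dots> \<le> real (k ^ t) / real (k ^ (l + t))"
  proof (rule frac_le)
    have "m - p * k ^ t \<le> k ^ t"
      using m by auto
    then show "real (m - p * k ^ t) \<le> real (k ^ t)"
      by (simp only: of_nat_le_iff)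
    show "real (k ^ (l + t)) \<le> real (k ^ (l + t)) * (real k - 1)"
      using k by (simp add: mult_le_cancel_left1)
  qed (use k in auto)
  moreover have "real (k ^ t) / real (k ^ (l + t)) = 1 / real (k ^ l)"
    using k by (simp add: power_add)
  ultimately show ?thesis
    by linarith
qed

text \<open>By uniform continuity \<open>h\<close> may be replaced on each arc of a fixed level
  \<open>l\<close> by its value at the left end; the arc masses have limits common to all
  components. So \<open>c\<close> depends on \<epsilon> but not on \<open>i\<close>.\<close>

lemma mean_approx:
  assumes h: "continuous_on {0..1} h" and \<epsilon>: "0 < \<epsilon>"
  shows "\<exists>c. \<forall>i. \<forall>\<^sub>F n in sequentially. \<bar>mean h n i - c\<bar> < \<epsilon>"
proof -
  have "uniformly_continuous_on {0..1} h"
    using h by (intro compact_uniformly_continuous) auto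
  then obtain d where d: "0 < d"
      "\<And>x y. x \<in> {0..1} \<Longrightarrow> y \<in> {0..1} \<Longrightarrow> dist y x < d \<Longrightarrow> dist (h y) (h x) < \<epsilon> / 2"
    using \<epsilon> unfolding uniformly_continuous_on_def by (metis half_gt_zero)
  \<comment> \<open>At this level the arcs are finer than the modulus of continuity
    \<open>d\<close>.\<close>
  obtain l where l: "1 / real (k ^ l) < d"
    using real_arch_pow_inv[OF d(1), of "1 / real k"] k by (auto simp: power_divide)
  define P where "P = {k ^ l..<k ^ Suc l}"
  define X where "X p t i = (\<Sum>m\<in>{p * k ^ t..<Suc p * k ^ t}. F i m)" for p t i
  obtain L where L: "\<And>p i. (\<lambda>t. X p t i / S (l + t) i) \<longlonglongrightarrow> L p"
    using block_mass_limit[of _ l] unfolding X_def by metis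
  define c where "c = (\<Sum>p\<in>P. h (atom_pos k l p) * L p)"
  define approx where "approx t i = (\<Sum>p\<in>P. h (atom_pos k l p) * (X p t i / S (l + t) i))" for t i
  \<comment> \<open>\<open>0 < t\<close> ensures \<open>0 < S (l + t) i\<close> also when
    \<open>l = 0\<close>.\<close>
  have near: "\<bar>mean h (l + t) i - approx t i\<bar> \<le> \<epsilon> / 2" if "0 < t" for t i
  proof -
    define n where "n = l + t"
    have Sn: "0 < S n i"
      using S_pos[of "n - 1" i] that by (simp add: n_def)
    \<comment> \<open>Numbers with \<open>n + 1\<close> digits are grouped by their leading
      \<open>l + 1\<close> digits.\<close>
    have split: "(\<Sum>m\<in>{k ^ n..<k ^ Suc n}. g m) = (\<Sum>p\<in>P. \<Sum>m\<in>{p * k ^ t..<Suc p * k ^ t}. g m)"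
      for g :: "nat \<Rightarrow> real"
      using sum_blocks[of g "k ^ l" "k ^ t" "k ^ Suc l"] by (simp add: P_def n_def power_add mult_ac)
    have hd: "\<bar>h (atom_pos k n m) - h (atom_pos k l p)\<bar> \<le> \<epsilon> / 2"
      if p: "p \<in> P" and m: "m \<in> {p * k ^ t..<Suc p * k ^ t}" for p m
    proof -
      have "k ^ l * k ^ t \<le> p * k ^ t" "Suc p * k ^ t \<le> k ^ Suc l * k ^ t"
        using p unfolding P_def by (intro mult_le_mono1; simp)+
      then have "k ^ l * k ^ t \<le> m" "m < k ^ Suc l * k ^ t"
        using m unfolding atLeastLessThan_iff by linarith+
      then have "m \<in> {k ^ n..<k ^ Suc n}"
        by (simp add: n_def power_add mult_ac)
      then have "atom_pos k n m \<in> {0..1}" "atom_pos k l p \<in> {0..1}"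
        using atom_pos_bounds[OF k] p unfolding P_def by (force intro: less_imp_le)+
      moreover have "dist (atom_pos k n m) (atom_pos k l p) < d"
        using atom_pos_block[of p l m t] p m l by (simp add: P_def n_def dist_real_def del: mult_Suc)
      ultimately show ?thesis
        using d(2) by (force simp: dist_real_def)
    qed
    have diff: "mean h n i - approx t i =
        (\<Sum>p\<in>P. \<Sum>m\<in>{p * k ^ t..<Suc p * k ^ t}. F i m * (h (atom_pos k n m) - h (atom_pos k l p))) / S n i"
      unfolding mean_def approx_def split X_def n_def[symmetric]
      by (simp add: right_diff_distrib sum_subtractf diff_divide_distrib sum_divide_distrib
          sum_distrib_left mult_ac del: mult_Suc)
    have "\<bar>mean h n i - approx t i\<bar> \<le> (\<Sum>p\<in>P. \<Sum>m\<in>{p * k ^ t..<Suc p * k ^ t}. F i m * (\<epsilon> / 2)) / S n i"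
    proof -
      have "\<bar>\<Sum>p\<in>P. \<Sum>m\<in>{p * k ^ t..<Suc p * k ^ t}. F i m * (h (atom_pos k n m) - h (atom_pos k l p))\<bar>
          \<le> (\<Sum>p\<in>P. \<Sum>m\<in>{p * k ^ t..<Suc p * k ^ t}. F i m * (\<epsilon> / 2))"
      proof (intro order_trans[OF sum_abs] sum_mono)
        fix p m assume "p \<in> P" "m \<in> {p * k ^ t..<Suc p * k ^ t}"
        from mult_left_mono[OF hd[OF this] F_nonneg[of i m]]
        show "\<bar>F i m * (h (atom_pos k n m) - h (atom_pos k l p))\<bar> \<le> F i m * (\<epsilon> / 2)"
          using F_nonneg[of i m] by (simp add: abs_mult)
      qed
      then show ?thesis
        unfolding diff using Sn by (simp add: abs_divide divide_right_mono del: mult_Suc)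
    qed
    also have "\<dots> = \<epsilon> / 2"
    proof -
      have "S n i = (\<Sum>p\<in>P. \<Sum>m\<in>{p * k ^ t..<Suc p * k ^ t}. F i m)"
        unfolding S_def by (rule split)
      then have "(\<Sum>p\<in>P. \<Sum>m\<in>{p * k ^ t..<Suc p * k ^ t}. F i m * (\<epsilon> / 2)) = S n i * (\<epsilon> / 2)"
        by (simp only: sum_distrib_right)
      then show ?thesis
        using Sn by simp
    qed
    finally show ?thesis
      by (simp add: n_def)
  qed
  have "\<forall>\<^sub>F n in sequentially. \<bar>mean h n i - c\<bar> < \<epsilon>" for i
  proof -
    have "(\<lambda>t. approx t i) \<longlonglongrightarrow> c"
      unfolding approx_def c_def by (intro tendsto_intros L)
    then have "\<forall>\<^sub>F t in sequentially. \<bar>approx t i - c\<bar> < \<epsilon> / 2"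
      using \<epsilon> by (auto dest!: tendstoD[of _ _ _ "\<epsilon> / 2"] simp: dist_real_def)
    then have "\<forall>\<^sub>F t in sequentially. \<bar>mean h (t + l) i - c\<bar> < \<epsilon>"
      using eventually_gt_at_top[of 0]
    proof eventually_elim
      case (elim t)
      then show ?case
        using near[of t i] unfolding add.commute[of t l] by linarith
    qed
    then show ?thesis
      by (subst (asm) eventually_sequentially_seg)
  qed
  then show ?thesis by blast
qed

text \<open>For each \<epsilon>, all components are eventually close to one constant from
  \<open>mean_approx\<close>; the subsequence forces \<Lambda> to be close to it as well.\<close>

lemma mean_tendsto:
  assumes h: "continuous_on {0..1} h" and s: "strict_mono s"
    and lim: "(\<lambda>n. mean h (s n) i0) \<longlonglongrightarrow> \<Lambda>"
  shows "(\<lambda>n. mean h n i) \<longlonglongrightarrow> \<Lambda>"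
proof (rule tendstoI)
  fix \<epsilon> :: real assume "0 < \<epsilon>"
  then obtain c where c: "\<And>i. \<forall>\<^sub>F n in sequentially. \<bar>mean h n i - c\<bar> < \<epsilon> / 2"
    using mean_approx[OF h, of "\<epsilon> / 2"] by auto
  have "\<forall>\<^sub>F n in sequentially. \<bar>mean h (s n) i0 - c\<bar> \<le> \<epsilon> / 2"
    using eventually_subseq[OF s c[of i0]] by (auto elim: eventually_mono)
  then have \<Lambda>: "\<bar>\<Lambda> - c\<bar> \<le> \<epsilon> / 2"
    using lim by (intro tendsto_upperbound[of "\<lambda>n. \<bar>mean h (s n) i0 - c\<bar>"]) (auto intro!: tendsto_intros)
  show "\<forall>\<^sub>F n in sequentially. dist (mean h n i) \<Lambda> < \<epsilon>"
    using c[of i]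
  proof eventually_elim
    case (elim n)
    then show ?case
      using \<Lambda> unfolding dist_real_def by linarith
  qed
qed

end

section \<open>Selection of the limit measure and identification of all limits\<close>

theorem theorem2p2:
  fixes k :: nat
    and f :: "nat \<Rightarrow> int"
    and i1 :: "'d::finite"
    and fs :: "'d \<Rightarrow> nat \<Rightarrow> int"
    and B :: "nat \<Rightarrow> int ^ 'd ^ 'd"
  assumes "k \<ge> 2"
    and "regular_seq k f"
    and "kernel_basis k f i1 fs"
    and "digit_matrices k fs B"
    and "primitive_seq k f B"
  shows "\<exists>\<mu>. prob_space \<mu> \<and> sets \<mu> = sets circle_borel \<and>
           (\<forall>i. weak_conv_circle (\<lambda>n. mu k (fs i) n) \<mu>)"
proof -
  note k = assms(1)
  have fs1: "fs i1 = f"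
    using assms(3) by (simp add: kernel_basis_def)
  have f_nonneg: "0 \<le> f m" for m
    using assms(5) by (simp add: primitive_seq_def)
  \<comment> \<open>Kernel elements are subsequences of \<open>f\<close> and inherit its
    sign.\<close>
  have nonneg: "0 \<le> fs i m" for i m
  proof -
    have "fs i \<in> kernel k f"
      using assms(3) by (auto simp: kernel_basis_def)
    then show ?thesis
      by (auto simp: kernel_def f_nonneg)
  qed
  interpret primitive_digit_system k "\<lambda>i m. real_of_int (fs i m)" "\<lambda>a i j. real_of_int (B a $ i $ j)"
  proof
    show "real_of_int (fs i (k * m + a)) = (\<Sum>j\<in>UNIV. real_of_int (B a $ i $ j) * real_of_int (fs j m))"
      if "a < k" for i m a
    proof -
      have "seq_vec fs (k * m + a) $ i = (B a *v seq_vec fs m) $ i"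
        using assms(4) that by (simp add: digit_matrices_def)
      then show ?thesis
        by (simp add: seq_vec_def matrix_vector_mult_def)
    qed
    show "0 < (\<Sum>a<k. real_of_int (B a $ i $ j))" for i j
    proof -
      have "0 < (\<Sum>a<k. B a) $ i $ j"
        using assms(5) by (simp add: primitive_seq_def)
      then show ?thesis
        by (simp flip: of_int_sum)
    qed
    \<comment> \<open>As \<open>f\<close> is not eventually zero, it has a non-zero value at some
      index at least 1.\<close>
    show "\<exists>i m. 1 \<le> m \<and> real_of_int (fs i m) \<noteq> 0"
      using assms(5) fs1 unfolding primitive_seq_def eventually_sequentially
      by (metis of_int_eq_0_iff)
  qed (use k nonneg in auto)
  have Sig: "real_of_int (Sig k (fs i) n) = S n i" for i n
    by (simp add: Sig_eq[OF k] S_def)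
  have atoms_mean: "(\<integral>m. h (atom_pos k n m) \<partial>atoms k (fs i) n) = mean h n i" for h n i
    by (simp add: integral_atoms nonneg Sig mean_def)

  \<comment> \<open>Starts at level 1, because at level 0 the total mass may vanish.\<close>
  define M where "M n = distr (atoms k f (Suc n)) borel (atom_pos k (Suc n))" for n
  have meas: "atom_pos k n \<in> measurable (atoms k u n) borel" for n u
    by (simp add: atoms_def measurable_def space_point_measure sets_point_measure)
  have prob: "prob_space (atoms k f (Suc n))" for n
    using prob_space_atoms[OF f_nonneg _ k] S_pos[of n i1] Sig[of i1 "Suc n"] by (simp add: fs1)
  have "tight M"
    unfolding tight_def
  proof (intro conjI allI impI)
    show "real_distribution (M n)" for n
      unfolding M_def by (rule prob_space.real_distribution_distr[OF prob meas])
    fix \<epsilon> :: real assume "0 < \<epsilon>"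
    \<comment> \<open>The left end -1 keeps the atom at 0 inside the half-open interval.\<close>
    have "measure (M n) {-1<..1} = 1" for n
    proof -
      have "atom_pos k (Suc n) -` {-1<..1} \<inter> space (atoms k f (Suc n)) = space (atoms k f (Suc n))"
        using atom_pos_bounds[OF k, of _ "Suc n"]
        by (fastforce simp: atoms_def space_point_measure simp del: power_Suc)
      then show ?thesis
        unfolding M_def using prob_space.prob_space[OF prob]
        by (subst measure_distr[OF meas]) auto
    qed
    then show "\<exists>x y. x < y \<and> (\<forall>n. 1 - \<epsilon> < measure (M n) {x<..y})"
      using \<open>0 < \<epsilon>\<close> by (intro exI[of _ "-1"] exI[of _ 1]) simp
  qed
  from tight_imp_convergent_subsubsequence[OF this strict_mono_id]
  obtain r N where r: "strict_mono r" and N: "real_distribution N" and conv: "weak_conv_m (M \<circ> id \<circ> r) N"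
    by blast
  interpret N: real_distribution N by (rule N)
  \<comment> \<open>Fixed before \<open>i\<close> and \<open>g\<close>, so the limit is common to
    all components.\<close>
  define \<mu> where "\<mu> = distr N circle_borel frac"
  have frac_meas: "frac \<in> measurable N circle_borel"
    using frac_measurable_circle by simp
  have "weak_conv_circle (\<lambda>n. mu k (fs i) n) \<mu>" for i
    unfolding weak_conv_circle_def
  proof (intro allI impI)
    fix g assume g: "continuous_map circle euclideanreal g"
    define h where "h x = g (frac x)" for x
    have cont: "continuous_on UNIV h"
      unfolding h_def by (rule continuous_map_circle_compose_frac[OF g])
    have g_meas: "g \<in> borel_measurable circle_borel"
      by (rule borel_measurable_circle[OF g])
    have int_mu: "(\<integral>x. g x \<partial>mu k (fs i) n) = mean h n i" for n
    proof -
      have "(\<integral>x. g x \<partial>mu k (fs i) n) = (\<integral>m. g (atom_pos k n m) \<partial>atoms k (fs i) n)"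
        unfolding mu_eq_distr[OF k] by (rule integral_distr[OF atom_pos_measurable_circle[OF k] g_meas])
      also have "\<dots> = (\<integral>m. h (atom_pos k n m) \<partial>atoms k (fs i) n)"
        using atom_pos_bounds[OF k]
        by (intro Bochner_Integration.integral_cong) (auto simp: h_def atoms_def space_point_measure frac_eq)
      finally show ?thesis
        by (simp add: atoms_mean)
    qed
    \<comment> \<open>Weak convergence on the line needs a bounded test function; by periodicity a
      bound on \<open>{0..1}\<close> suffices.\<close>
    have "compact (h ` {0..1})"
      using cont by (intro compact_continuous_image) (auto intro: continuous_on_subset)
    then obtain C where C: "\<And>y. y \<in> h ` {0..1} \<Longrightarrow> norm y \<le> C"
      using compact_imp_bounded bounded_iff by metis
    have bdd: "norm (h x) \<le> C" for x
    proof -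
      have "h x = h (frac x)"
        by (simp add: h_def)
      then show ?thesis
        using C frac_ge_0[of x] frac_lt_1[of x] by (metis atLeastAtMost_iff imageI less_imp_le)
    qed
    have "(\<lambda>n. integral\<^sup>L ((M \<circ> id \<circ> r) n) h) \<longlonglongrightarrow> integral\<^sup>L N h"
    proof (rule weak_conv_imp_integral_bdd_continuous_conv[OF _ N conv _ bdd])
      show "real_distribution ((M \<circ> id \<circ> r) n)" for n
        using \<open>tight M\<close> by (simp add: tight_def)
      show "isCont h x" for x
        using cont by (simp add: continuous_on_eq_continuous_at)
    qed
    moreover have "integral\<^sup>L (M n) h = mean h (Suc n) i1" for n
      unfolding M_def using cont
      by (subst integral_distr[OF meas]) (auto simp: borel_measurable_continuous_onI fs1 simp flip: atoms_mean)
    moreover have "integral\<^sup>L N h = (\<integral>x. g x \<partial>\<mu>)"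
      unfolding \<mu>_def h_def by (rule integral_distr[symmetric, OF frac_meas g_meas])
    ultimately have "(\<lambda>n. mean h (Suc (r n)) i1) \<longlonglongrightarrow> (\<integral>x. g x \<partial>\<mu>)"
      by simp
    moreover have "strict_mono (\<lambda>n. Suc (r n))"
      using r by (simp add: strict_mono_def)
    \<comment> \<open>Passes from the subsequence for \<open>i1\<close> to the full sequence for
      arbitrary \<open>i\<close>.\<close>
    ultimately have "(\<lambda>n. mean h n i) \<longlonglongrightarrow> (\<integral>x. g x \<partial>\<mu>)"
      using mean_tendsto[of h "\<lambda>n. Suc (r n)" i1] cont by (auto intro: continuous_on_subset)
    then show "(\<lambda>n. \<integral>x. g x \<partial>mu k (fs i) n) \<longlonglongrightarrow> (\<integral>x. g x \<partial>\<mu>)"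
      by (simp add: int_mu)
  qed
  moreover have "prob_space \<mu>"
    unfolding \<mu>_def by (rule N.prob_space_distr[OF frac_meas])
  moreover have "sets \<mu> = sets circle_borel"
    by (simp add: \<mu>_def)
  ultimately show ?thesis by blast
qed

end
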